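(* As formal power series in $q$ with coefficients polynomial in $x$ (equivalently, for complex $q$ with $|q|<1$), we have \begin{align*} \sum_{i, j\geq 0}\frac{(-1)^jx^{i+j}q^{i^2+2ij+j^2}}{(q^8; q^8)_i(q^8; q^8)_j}&=\sum_{n\geq 0}\frac{x^{2n}q^{4n^2}}{(q^{16}; q^{16})_{n}},\\ \sum_{i, j\geq 0}\frac{(-1)^{\binom{i-j}{2}}x^{i+j}q^{3i^2+2ij+3j^2}}{(q^4; q^4)_i(q^4; q^4)_j}&=\sum_{n\geq 0}\frac{x^{2n}q^{8n^2}}{(q^{8}; q^{8})_{n}}. \end{align*}
   Context: $(a;q)_n=(1-a)(1-aq)\cdots(1-aq^{n-1})$ for $n\ge1$, $(a;q)_0=1$. For an integer $m$ (possibly negative), $\binom{m}{2}=m(m-1)/2$. *)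

theory Defs
  imports
    "HOL-Analysis.Analysis"
    "HOL-Computational_Algebra.Computational_Algebra"
begin

definition qpoch :: "'a::comm_ring_1 \<Rightarrow> 'a \<Rightarrow> nat \<Rightarrow> 'a" where
  "qpoch a q n = (\<Prod>k<n. 1 - a * q ^ k)"

definition binom2 :: "int \<Rightarrow> int" where
  "binom2 m = m * (m - 1) div 2"

text \<open>The division is exact and the value is nonnegative also for negative \<open>m\<close>, so
  \<open>(-1) ^ nat (binom2 m)\<close> truncates nothing.\<close>

lemma two_binom2: "2 * binom2 m = m * (m - 1)"
proof -
  have "even (m * (m - 1))" by auto
  then show ?thesis unfolding binom2_def by simp
qed

lemma binom2_nonneg: "0 \<le> binom2 m"
proof (cases "m \<le> 0")
  case True
  then have "0 \<le> m * (m - 1)" by (simp add: mult_nonpos_nonpos)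
  then show ?thesis using two_binom2[of m] by linarith
next
  case False
  then have "0 \<le> m * (m - 1)" by simp
  then show ?thesis using two_binom2[of m] by linarith
qed

text \<open>Formal power series in \<open>q\<close> with coefficients in the polynomial ring \<open>\<int>[x]\<close>.  Their
  library topology is the \<open>q\<close>-adic one, so \<open>has_sum\<close> is the usual formal summation.\<close>

abbreviation formal_x :: "int poly fps" where
  "formal_x \<equiv> fps_const [:0, 1:]"

abbreviation formal_q :: "int poly fps" where
  "formal_q \<equiv> fps_X"

text \<open>The reciprocal of a series with constant term 1; the library's \<open>inverse\<close> on power series
  is unavailable here because the coefficient ring has no \<open>inverse\<close> operation.\<close>

definition fps_recip :: "'a::comm_ring_1 fps \<Rightarrow> 'a fps" where
  "fps_recip f = fps_right_inverse f 1"

lemma fps_recip: "fps_nth f 0 = 1 \<Longrightarrow> f * fps_recip f = 1"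
  unfolding fps_recip_def by (rule fps_right_inverse) simp

lemma fps_nth_0_qpoch_fps_X:
  assumes "0 < k"
  shows "fps_nth (qpoch (fps_X ^ k) (fps_X ^ k) n :: 'a::comm_ring_1 fps) 0 = 1"
  using assms by (induction n) (simp_all add: qpoch_def)

end

theory Submission
  imports Defs
begin

text \<open>Both double sums are summed along the diagonals \<open>i + j = N\<close>.  There the exponents are
  \<open>N\<^sup>2\<close> and \<open>3 * i\<^sup>2 + 2 * i * j + 3 * j\<^sup>2 = N\<^sup>2 + 2 * i\<^sup>2 + 2 * j\<^sup>2\<close>, and the second sign is
  \<open>(-1) ^ j\<close> up to a sign depending on \<open>N\<close> only, so each diagonal is a convolution of a sequence
  with its alternating version, that is, a coefficient of \<open>F z * F (- z)\<close>.  The \<open>q\<close>-difference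
  equation of \<open>F\<close> turns into a two-step recurrence for these coefficients, which kills the odd ones
  and evaluates the even ones.\<close>

section \<open>Recurrences for reciprocals of q-factorials\<close>

lemma qpoch_Suc: "qpoch Q Q (Suc n) = qpoch Q Q n * (1 - Q ^ Suc n)"
  by (simp add: qpoch_def)

text \<open>Assuming only \<open>a n * qpoch Q Q n = 1\<close> in a domain lets one argument serve
  both power series and complex numbers. The assumption makes \<open>qpoch Q Q n\<close> nonzero,
  hence cancellable.\<close>

lemma recip_qpoch_Suc:
  fixes a :: "nat \<Rightarrow> 'a::idom"
  assumes "\<And>n. a n * qpoch Q Q n = 1"
  shows "a (Suc n) * (1 - Q ^ Suc n) = a n"
proof -
  have "a (Suc n) * (1 - Q ^ Suc n) * qpoch Q Q n = 1"
    using assms[of "Suc n"] by (simp add: qpoch_Suc mult_ac)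
  then have "(a (Suc n) * (1 - Q ^ Suc n)) * qpoch Q Q n = a n * qpoch Q Q n"
    by (simp add: assms)
  moreover have "qpoch Q Q n \<noteq> 0"
    using assms[of n] by auto
  ultimately show ?thesis by simp
qed

lemma one_minus_power_nonzero:
  fixes a :: "nat \<Rightarrow> 'a::idom"
  assumes "\<And>n. a n * qpoch Q Q n = 1"
  shows "1 - Q ^ Suc n \<noteq> 0"
  using assms[of "Suc n"] by (auto simp: qpoch_Suc)

lemma recip_qpoch_0:
  assumes "\<And>n. a n * qpoch Q Q n = 1"
  shows "a 0 = 1"
  using assms[of 0] by (simp add: qpoch_def)

section \<open>Alternating convolutions via q-difference equations\<close>

text \<open>\<open>fps_X\<close> is here an auxiliary variable z, independent of q: for the formal
  identities the coefficients are themselves power series in q.\<close>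

lemma alternating_convolution_eq_fps_nth:
  fixes a :: "nat \<Rightarrow> 'a::comm_ring_1"
  shows "(\<Sum>i\<le>N. (-1) ^ (N - i) * a i * a (N - i))
    = fps_nth (Abs_fps a * Abs_fps (\<lambda>n. (-1) ^ n * a n)) N"
  by (simp add: fps_mult_nth atLeast0AtMost mult_ac)

text \<open>The nonzero \<open>d\<close> can be cancelled, so the recurrence determines
  \<open>g\<close> from \<open>g 0\<close> and \<open>g 1 = 0\<close>. \<open>d n\<close> is the
  factor of \<open>g (Suc n)\<close>, so the step for \<open>h\<close> carries the odd index
  \<open>Suc (2 * m)\<close>.\<close>

lemma even_supported_recurrence:
  fixes g :: "nat \<Rightarrow> 'a::idom"
  assumes rec: "\<And>n. g (Suc (Suc n)) * d (Suc n) = c n * g n"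
    and "g 1 * d 0 = 0" and d: "\<And>n. d n \<noteq> 0" and "g 0 = h 0"
    and h: "\<And>m. h (Suc m) * d (Suc (2 * m)) = c (2 * m) * h m"
  shows "g N = (if even N then h (N div 2) else 0)"
proof (induction N rule: induct_nat_012)
  case 0
  show ?case using assms by simp
next
  case 1
  show ?case using assms(2) d[of 0] by simp
next
  case (ge2 n)
  show ?case
  proof (cases "even n")
    case True
    then obtain m where m: "n = 2 * m" by (elim evenE)
    have "g (Suc (Suc n)) * d (Suc n) = h (Suc m) * d (Suc n)"
      using rec[of n] h[of m] ge2 m by simp
    then show ?thesis using d[of "Suc n"] m by simp
  next
    case False
    then show ?thesis using rec[of n] d[of "Suc n"] ge2 by simp
  qed
qed

text \<open>With \<open>E(z) = (\<Sum>n. a n * z ^ n)\<close> one has \<open>E (Q * z) = (1 - z) * E z\<close>, so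
  \<open>G z = E z * E (- z)\<close> satisfies \<open>G (Q * z) = (1 - z\<^sup>2) * G z\<close>.\<close>

lemma alternating_convolution_recip_qpoch:
  fixes a e :: "nat \<Rightarrow> 'a::idom"
  assumes a: "\<And>n. a n * qpoch Q Q n = 1"
    and e: "\<And>n. e n * qpoch (Q ^ 2) (Q ^ 2) n = 1"
  shows "(\<Sum>i\<le>N. (-1) ^ (N - i) * a i * a (N - i)) = (if even N then e (N div 2) else 0)"
proof -
  define E where "E = Abs_fps a"
  define E' where "E' = Abs_fps (\<lambda>n. (-1) ^ n * a n)"
  define G where "G = E * E'"
  define L where "L = fps_const Q * (fps_X :: 'a fps)"
  have E_L: "E oo L = (1 - fps_X) * E"
  proof (rule fps_ext)
    fix n show "fps_nth (E oo L) n = fps_nth ((1 - fps_X) * E) n"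
      unfolding E_def L_def fps_compose_linear using recip_qpoch_Suc[of a, OF a, of "n - 1"]
      by (cases n) (auto simp: algebra_simps)
  qed
  have E'_L: "E' oo L = (1 + fps_X) * E'"
  proof (rule fps_ext)
    fix n show "fps_nth (E' oo L) n = fps_nth ((1 + fps_X) * E') n"
    proof (cases n)
      case (Suc k)
      have "a k = a (Suc k) * (1 - Q ^ Suc k)"
        by (rule recip_qpoch_Suc[of a, OF a, symmetric])
      then show ?thesis
        by (simp add: Suc E'_def L_def fps_compose_linear distrib_right) (simp add: algebra_simps)
    qed (simp add: E'_def L_def)
  qed
  have "G oo L = (E oo L) * (E' oo L)"
    unfolding G_def by (rule fps_compose_mult_distrib) (simp add: L_def)
  also have "\<dots> = G - fps_X * (fps_X * G)"
    unfolding E_L E'_L G_def by (simp add: algebra_simps)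
  \<comment> \<open>At z^n this says that 1 - Q^n times the coefficient of \<open>G\<close> is the
    coefficient two places earlier, read as 0 for n < 2.\<close>
  finally have G: "Q ^ n * fps_nth G n = fps_nth (G - fps_X * (fps_X * G)) n" for n
    by (metis L_def fps_compose_linear fps_nth_Abs_fps)
  have "fps_nth G N = (if even N then e (N div 2) else 0)"
  proof (rule even_supported_recurrence[where d = "\<lambda>n. 1 - Q ^ Suc n" and c = "\<lambda>_. 1"])
    show "fps_nth G (Suc (Suc n)) * (1 - Q ^ Suc (Suc n)) = 1 * fps_nth G n" for n
      using G[of "Suc (Suc n)"] by (simp add: algebra_simps)
    show "fps_nth G 1 * (1 - Q ^ Suc 0) = 0"
      using G[of 1] by (simp add: algebra_simps)
    show "1 - Q ^ Suc n \<noteq> 0" for n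
      by (rule one_minus_power_nonzero[OF a])
    show "fps_nth G 0 = e 0"
      using recip_qpoch_0[OF a] recip_qpoch_0[OF e] by (simp add: G_def E_def E'_def)
    \<comment> \<open>As (Q^2)^(m+1) = Q^(2m+2), the recurrence of \<open>e\<close> for base Q^2 is
      the even half of that for \<open>G\<close>.\<close>
    show "e (Suc m) * (1 - Q ^ Suc (Suc (2 * m))) = 1 * e m" for m
      using recip_qpoch_Suc[of e, OF e, of m] by (simp flip: power_mult del: power_Suc)
  qed
  then show ?thesis
    by (simp add: alternating_convolution_eq_fps_nth G_def E_def E'_def)
qed

text \<open>The same argument for \<open>B(z) = (\<Sum>n. p ^ n\<^sup>2 * a n * z ^ n)\<close>, where \<open>Q = p\<^sup>2\<close>: here
  \<open>B z = (1 + p * z) * B (Q * z)\<close>.\<close>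

lemma alternating_convolution_recip_qpoch_squares:
  fixes a e :: "nat \<Rightarrow> 'a::idom"
  assumes Q: "Q = p ^ 2" and a: "\<And>n. a n * qpoch Q Q n = 1"
    and e: "\<And>n. e n * qpoch (Q ^ 2) (Q ^ 2) n = 1"
  shows "(\<Sum>i\<le>N. (-1) ^ (N - i) * (p ^ i\<^sup>2 * a i) * (p ^ (N - i)\<^sup>2 * a (N - i)))
    = (if even N then (-1) ^ (N div 2) * Q ^ (N div 2)\<^sup>2 * e (N div 2) else 0)"
proof -
  define b where "b n = p ^ n\<^sup>2 * a n" for n
  define B where "B = Abs_fps b"
  define B' where "B' = Abs_fps (\<lambda>n. (-1) ^ n * b n)"
  define H where "H = B * B'"
  define L where "L = fps_const Q * (fps_X :: 'a fps)"
  \<comment> \<open>The coefficient of z^(n+1) in the equation for B: the recurrence of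
    \<open>a\<close> combined with (n+1)^2 = n^2 + 2n + 1 and Q = p^2.\<close>
  have b_Suc: "b (Suc n) = Q ^ Suc n * b (Suc n) + p * (Q ^ n * b n)" for n
  proof -
    have "p ^ (Suc n)\<^sup>2 = p * Q ^ n * p ^ n\<^sup>2"
      by (simp add: Q power2_eq_square flip: power_add power_mult)
        (simp add: power_add power_mult mult_ac power2_eq_square power_mult_distrib)
    moreover have "b (Suc n) * (1 - Q ^ Suc n) = p ^ (Suc n)\<^sup>2 * a n"
      using recip_qpoch_Suc[of a, OF a, of n] by (simp add: b_def mult.assoc)
    ultimately have "b (Suc n) * (1 - Q ^ Suc n) = p * (Q ^ n * b n)"
      by (simp add: b_def mult_ac)
    then show ?thesis by (simp add: algebra_simps)
  qed
  have B_L: "B = (1 + fps_const p * fps_X) * (B oo L)"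
  proof (rule fps_ext)
    fix n show "fps_nth B n = fps_nth ((1 + fps_const p * fps_X) * (B oo L)) n"
    proof (cases n)
      case 0
      then show ?thesis by (simp add: B_def L_def)
    next
      case (Suc k)
      then show ?thesis using b_Suc[of k]
        by (simp add: B_def L_def fps_compose_linear distrib_right mult.assoc)
    qed
  qed
  have B'_L: "B' = (1 - fps_const p * fps_X) * (B' oo L)"
  proof (rule fps_ext)
    fix n show "fps_nth B' n = fps_nth ((1 - fps_const p * fps_X) * (B' oo L)) n"
    proof (cases n)
      case 0
      then show ?thesis by (simp add: B'_def L_def)
    next
      case (Suc k)
      have "p * (Q ^ k * ((-1) ^ k * b k)) = (-1) ^ k * (p * (Q ^ k * b k))"
        by (simp only: mult_ac)
      also have "p * (Q ^ k * b k) = b (Suc k) - Q ^ Suc k * b (Suc k)"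
        using b_Suc[of k] by (metis add_diff_cancel_left')
      finally have "(-1) ^ n * b n = Q ^ n * ((-1) ^ n * b n) - p * (Q ^ k * ((-1) ^ k * b k))"
        by (simp add: Suc algebra_simps)
      then show ?thesis
        unfolding B'_def L_def fps_compose_linear Suc
        by (simp add: left_diff_distrib mult.assoc del: power_Suc)
    qed
  qed
  have "H = (1 + fps_const p * fps_X) * (1 - fps_const p * fps_X) * ((B oo L) * (B' oo L))"
    unfolding H_def by (subst B_L, subst B'_L) (simp only: mult_ac)
  also have "(B oo L) * (B' oo L) = H oo L"
    unfolding H_def by (rule fps_compose_mult_distrib[symmetric]) (simp add: L_def)
  \<comment> \<open>Hence H(z) = (1 - Q z^2) H(Q z). At z^(n+2) the shifted term gets Q from the
    factor and Q^n from the substitution, which gives the coefficient \<open>- (Q ^ Suc n)\<close>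
    below.\<close>
  also have "(1 + fps_const p * fps_X) * (1 - fps_const p * fps_X) * (H oo L)
    = (H oo L) - fps_const Q * (fps_X * (fps_X * (H oo L)))"
    unfolding Q power2_eq_square fps_const_mult[symmetric] by (simp only: ring_distribs mult_ac) simp
  finally have H: "fps_nth H n = fps_nth ((H oo L) - fps_const Q * (fps_X * (fps_X * (H oo L)))) n" for n
    by simp
  \<comment> \<open>The even steps contribute factors -Q^(2k+1) for k < m; the odd exponents add up
    to m^2.\<close>
  define h where "h m = (-1) ^ m * Q ^ m\<^sup>2 * e m" for m
  have "fps_nth H N = (if even N then h (N div 2) else 0)"
  proof (rule even_supported_recurrence[where d = "\<lambda>n. 1 - Q ^ Suc n" and c = "\<lambda>n. - (Q ^ Suc n)"])
    show "fps_nth H (Suc (Suc n)) * (1 - Q ^ Suc (Suc n)) = - (Q ^ Suc n) * fps_nth H n" for n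
      using H[of "Suc (Suc n)"] unfolding L_def fps_compose_linear by (simp add: algebra_simps)
    show "fps_nth H 1 * (1 - Q ^ Suc 0) = 0"
      using H[of 1] unfolding L_def fps_compose_linear by (simp add: algebra_simps)
    show "1 - Q ^ Suc n \<noteq> 0" for n
      by (rule one_minus_power_nonzero[OF a])
    show "fps_nth H 0 = h 0"
      using recip_qpoch_0[OF a] recip_qpoch_0[OF e]
      by (simp add: H_def B_def B'_def b_def h_def)
    show "h (Suc m) * (1 - Q ^ Suc (Suc (2 * m))) = - (Q ^ Suc (2 * m)) * h m" for m
    proof -
      have "(Q ^ 2) ^ Suc m = Q ^ Suc (Suc (2 * m))"
        by (simp add: power2_eq_square power_mult)
      then have "e (Suc m) * (1 - Q ^ Suc (Suc (2 * m))) = e m"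
        using recip_qpoch_Suc[of e, OF e, of m] by metis
      then have "h (Suc m) * (1 - Q ^ Suc (Suc (2 * m))) = (-1) ^ Suc m * Q ^ (Suc m)\<^sup>2 * e m"
        by (simp only: h_def mult.assoc)
      moreover have "(Suc m)\<^sup>2 = Suc (2 * m) + m\<^sup>2"
        by (simp add: power2_eq_square)
      ultimately show ?thesis by (simp only: h_def power_add) simp
    qed
  qed
  then show ?thesis
    by (simp add: alternating_convolution_eq_fps_nth H_def B_def B'_def h_def flip: b_def)
qed

section \<open>Signs and the evaluation of one diagonal\<close>

text \<open>The binomial coefficients at i + j and i - j differ by 2ij - j, so along a diagonal the
  sign is (-1)^j up to a fixed factor.\<close>

lemma minus_one_power_binom2:
  "(-1 :: 'a::comm_ring_1) ^ nat (binom2 (int i - int j)) = (-1) ^ nat (binom2 (int (i + j))) * (-1) ^ j"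
proof -
  have "2 * binom2 (int (i + j)) = 2 * (binom2 (int i - int j) + (2 * int i * int j - int j))"
    unfolding distrib_left two_binom2 by (simp add: algebra_simps)
  then have "binom2 (int (i + j)) + int j = binom2 (int i - int j) + 2 * (int i * int j)"
    by simp
  then have "nat (binom2 (int (i + j))) + j = nat (binom2 (int i - int j)) + 2 * (i * j)"
    using binom2_nonneg[of "int (i + j)"] binom2_nonneg[of "int i - int j"]
    by (simp add: nat_eq_iff flip: of_nat_eq_iff[where 'a = int])
  then have "(-1 :: 'a) ^ (nat (binom2 (int (i + j))) + j)
      = (-1) ^ (nat (binom2 (int i - int j)) + 2 * (i * j))"
    by (rule arg_cong)
  then show ?thesis by (simp add: power_add power_mult)
qed

text \<open>The binomial coefficient is 2m^2 - m, of the parity of m. This sign cancels the one in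
  the convolution weighted by squares.\<close>

lemma minus_one_power_binom2_even:
  "(-1 :: 'a::comm_ring_1) ^ nat (binom2 (int (2 * m))) = (-1) ^ m"
proof -
  have "binom2 (int (2 * m)) = int m * (2 * int m - 1)"
    by (simp add: binom2_def)
  then have "nat (binom2 (int (2 * m))) + 2 * m = m + 2 * (m * m)"
    using binom2_nonneg[of "int (2 * m)"]
    by (simp add: nat_eq_iff algebra_simps flip: of_nat_eq_iff[where 'a = int])
  then have "(-1 :: 'a) ^ (nat (binom2 (int (2 * m))) + 2 * m) = (-1) ^ (m + 2 * (m * m))"
    by (rule arg_cong)
  then show ?thesis by (simp add: power_add power_mult)
qed

text \<open>The factor x^N q^(N^2) is constant on the diagonal and leaves the plain alternating
  convolution with Q = q^8; N = 2m turns N^2 into 4m^2. Abstract reciprocals \<open>a\<close> and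
  \<open>e\<close> cover the formal and the complex summands.\<close>

lemma diagonal_sum1:
  fixes x q :: "'a::idom"
  assumes a: "\<And>n. a n * qpoch (q ^ 8) (q ^ 8) n = 1"
    and e: "\<And>n. e n * qpoch (q ^ 16) (q ^ 16) n = 1"
    and f: "\<And>i j. f (i, j) = (-1) ^ j * x ^ (i + j) * q ^ (i\<^sup>2 + 2 * i * j + j\<^sup>2) * (a i * a j)"
  shows "(\<Sum>i\<le>N. f (i, N - i))
    = (if even N then x ^ (2 * (N div 2)) * q ^ (4 * (N div 2)\<^sup>2) * e (N div 2) else 0)"
proof -
  have "f (i, N - i) = x ^ N * q ^ N\<^sup>2 * ((-1) ^ (N - i) * a i * a (N - i))" if le: "i \<le> N" for i
  proof -
    obtain j where N: "N = i + j"
      using le_Suc_ex[OF le] by blast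
    have "i\<^sup>2 + 2 * i * j + j\<^sup>2 = N\<^sup>2"
      by (simp add: N power2_sum)
    then have "f (i, j) = (-1) ^ j * x ^ N * q ^ N\<^sup>2 * (a i * a j)"
      by (simp only: f N)
    then show ?thesis by (simp add: N mult_ac)
  qed
  then have "(\<Sum>i\<le>N. f (i, N - i))
      = x ^ N * q ^ N\<^sup>2 * (\<Sum>i\<le>N. (-1) ^ (N - i) * a i * a (N - i))"
    by (simp add: sum_distrib_left)
  also have "\<dots> = x ^ N * q ^ N\<^sup>2 * (if even N then e (N div 2) else 0)"
    using alternating_convolution_recip_qpoch[of a "q ^ 8" e N] a e by (simp flip: power_mult)
  also have "\<dots> = (if even N then x ^ (2 * (N div 2)) * q ^ (4 * (N div 2)\<^sup>2) * e (N div 2) else 0)"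
    by (auto elim!: evenE simp: power_mult_distrib)
  finally show ?thesis .
qed

text \<open>The excess 2i^2 + 2j^2 of the exponent over N^2 supplies the square weights with p =
  q^2, so Q = q^4. For N = 2m, N^2 and the 4m^2 from Q^(m^2) add up to 8m^2, and two signs (-1)^m
  cancel.\<close>

lemma diagonal_sum2:
  fixes x q :: "'a::idom"
  assumes a: "\<And>n. a n * qpoch (q ^ 4) (q ^ 4) n = 1"
    and e: "\<And>n. e n * qpoch (q ^ 8) (q ^ 8) n = 1"
    and f: "\<And>i j. f (i, j) = (-1) ^ nat (binom2 (int i - int j)) * x ^ (i + j)
      * q ^ (3 * i\<^sup>2 + 2 * i * j + 3 * j\<^sup>2) * (a i * a j)"
  shows "(\<Sum>i\<le>N. f (i, N - i))
    = (if even N then x ^ (2 * (N div 2)) * q ^ (8 * (N div 2)\<^sup>2) * e (N div 2) else 0)"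
proof -
  define s where "s = (-1 :: 'a) ^ nat (binom2 (int N))"
  have "f (i, N - i) = s * x ^ N * q ^ N\<^sup>2
      * ((-1) ^ (N - i) * ((q ^ 2) ^ i\<^sup>2 * a i) * ((q ^ 2) ^ (N - i)\<^sup>2 * a (N - i)))" if le: "i \<le> N" for i
  proof -
    obtain j where N: "N = i + j"
      using le_Suc_ex[OF le] by blast
    have "3 * i\<^sup>2 + 2 * i * j + 3 * j\<^sup>2 = N\<^sup>2 + 2 * i\<^sup>2 + 2 * j\<^sup>2"
      by (simp add: N power2_sum)
    then have "q ^ (3 * i\<^sup>2 + 2 * i * j + 3 * j\<^sup>2) = q ^ N\<^sup>2 * (q ^ 2) ^ i\<^sup>2 * (q ^ 2) ^ j\<^sup>2"
      by (simp only: power_add power_mult)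
    moreover have "(-1 :: 'a) ^ nat (binom2 (int i - int j)) = s * (-1) ^ j"
      unfolding s_def N by (rule minus_one_power_binom2)
    ultimately have "f (i, j) = s * (-1) ^ j * x ^ N * (q ^ N\<^sup>2 * (q ^ 2) ^ i\<^sup>2 * (q ^ 2) ^ j\<^sup>2) * (a i * a j)"
      by (simp only: f N)
    then show ?thesis by (simp only: N add_diff_cancel_left' mult_ac)
  qed
  then have "(\<Sum>i\<le>N. f (i, N - i)) = s * x ^ N * q ^ N\<^sup>2
      * (\<Sum>i\<le>N. (-1) ^ (N - i) * ((q ^ 2) ^ i\<^sup>2 * a i) * ((q ^ 2) ^ (N - i)\<^sup>2 * a (N - i)))"
    by (simp add: sum_distrib_left)
  also have "\<dots> = s * x ^ N * q ^ N\<^sup>2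
      * (if even N then (-1) ^ (N div 2) * (q ^ 4) ^ (N div 2)\<^sup>2 * e (N div 2) else 0)"
    using alternating_convolution_recip_qpoch_squares[of "q ^ 4" "q ^ 2" a e N] a e
    by (simp flip: power_mult)
  also have "\<dots> = (if even N then x ^ (2 * (N div 2)) * q ^ (8 * (N div 2)\<^sup>2) * e (N div 2) else 0)"
  proof (cases "even N")
    case True
    then obtain m where m: "N = 2 * m" by (elim evenE)
    have s: "s = (-1) ^ m"
      unfolding s_def m by (rule minus_one_power_binom2_even)
    have "q ^ (8 * m\<^sup>2) = q ^ (2 * m)\<^sup>2 * (q ^ 4) ^ m\<^sup>2"
      by (simp add: power_mult_distrib flip: power_mult power_add)
    moreover have "(-1 :: 'a) ^ m * (-1) ^ m = 1"
      by (simp flip: power_mult_distrib)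
    ultimately show ?thesis using True
      by (simp add: s m mult_ac)
  qed simp
  finally show ?thesis .
qed

section \<open>Summing by diagonals and keeping the even ones\<close>

lemma has_sum_even_supported:
  fixes g :: "nat \<Rightarrow> 'a::{comm_monoid_add, topological_space}"
  assumes "(g has_sum S) UNIV" and g: "\<And>n. g n = (if even n then h (n div 2) else 0)"
  shows "(h has_sum S) UNIV"
proof -
  have "(g has_sum S) (range ((*) 2))"
    by (rule has_sum_cong_neutral[THEN iffD1, OF _ _ _ assms(1)])
      (auto simp: g image_iff elim: evenE)
  then show ?thesis
    by (subst (asm) has_sum_reindex) (auto simp: o_def inj_on_def g)
qed

text \<open>The term at (i, j) has order at least i + j, so each coefficient of the partial sums is
  eventually constant, which is convergence in the topology of power series.\<close>

lemma fps_has_sum_diagonals: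
  fixes f :: "nat \<times> nat \<Rightarrow> 'a::comm_ring_1 fps"
  assumes "\<And>i j n. n < i + j \<Longrightarrow> fps_nth (f (i, j)) n = 0"
  obtains S where "(f has_sum S) UNIV" "((\<lambda>N. \<Sum>i\<le>N. f (i, N - i)) has_sum S) UNIV"
proof
  define S where "S = Abs_fps (\<lambda>n. \<Sum>N\<le>n. fps_nth (\<Sum>i\<le>N. f (i, N - i)) n)"
  show "((\<lambda>N. \<Sum>i\<le>N. f (i, N - i)) has_sum S) UNIV"
    unfolding has_sum_def
  proof (rule tendsto_fpsI)
    fix n
    have "fps_nth (\<Sum>N\<in>F. \<Sum>i\<le>N. f (i, N - i)) n = fps_nth S n" if "finite F" "{..n} \<subseteq> F" for F
      unfolding S_def fps_nth_Abs_fps fps_sum_nth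
      by (rule sum.mono_neutral_right) (use that assms in auto)
    then show "\<forall>\<^sub>F F in finite_subsets_at_top UNIV.
        fps_nth (\<Sum>N\<in>F. \<Sum>i\<le>N. f (i, N - i)) n = fps_nth S n"
      unfolding eventually_finite_subsets_at_top by (intro exI[of _ "{..n}"]) auto
  qed
  show "(f has_sum S) UNIV"
    unfolding has_sum_def
  proof (rule tendsto_fpsI)
    fix n
    \<comment> \<open>The triangle of all indices that can reach coefficient n; summed by diagonals
      it gives the coefficient of \<open>S\<close>.\<close>
    define P where "P = {(i :: nat, j). i + j \<le> n}"
    have "finite P"
      by (rule finite_subset[of _ "{..n} \<times> {..n}"]) (auto simp: P_def)
    have "fps_nth (sum f F) n = fps_nth S n" if "finite F" "P \<subseteq> F" for F
    proof -
      have "fps_nth (sum f F) n = (\<Sum>p\<in>P. fps_nth (f p) n)"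
        unfolding fps_sum_nth
        by (rule sum.mono_neutral_right) (use that assms in \<open>auto simp: P_def not_less[symmetric]\<close>)
      also have "\<dots> = (\<Sum>(i, j)\<in>P. fps_nth (f (i, j)) n)"
        by simp
      also have "\<dots> = fps_nth S n"
        unfolding P_def sum.triangle_reindex_eq by (simp add: S_def fps_sum_nth)
      finally show ?thesis .
    qed
    then show "\<forall>\<^sub>F F in finite_subsets_at_top UNIV. fps_nth (sum f F) n = fps_nth S n"
      using \<open>finite P\<close> unfolding eventually_finite_subsets_at_top by (intro exI[of _ P]) auto
  qed
qed

text \<open>Absolute summability in a complete space yields a sum. The bijection (i, j) -> (i + j,
  i) moves it to the pairs (N, i) with i \<le> N, where the finite inner sums over i are taken
  first.\<close>

lemma has_sum_diagonals:
  fixes f :: "nat \<times> nat \<Rightarrow> 'a::banach"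
  assumes "(\<lambda>p. norm (f p)) summable_on UNIV"
  obtains S where "(f has_sum S) UNIV" "((\<lambda>N. \<Sum>i\<le>N. f (i, N - i)) has_sum S) UNIV"
proof
  show f: "(f has_sum infsum f UNIV) UNIV"
    using Infinite_Sum.abs_summable_summable[OF assms] by simp
  have "((\<lambda>(N, i). f (i, N - i)) has_sum infsum f UNIV) (Sigma UNIV (\<lambda>N. {..N}))"
    by (rule has_sum_reindex_bij_witness[where i = "\<lambda>(i, j). (i + j, i)" and
          j = "\<lambda>(N, i). (i, N - i)", THEN iffD2, OF _ _ _ _ _ _ f]) auto
  then show "((\<lambda>N. \<Sum>i\<le>N. f (i, N - i)) has_sum infsum f UNIV) UNIV"
    by (rule has_sum_SigmaD) auto
qed

section \<open>Absolute convergence for |q| < 1\<close>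

text \<open>The terms are (u r^n)^n with u r^n tending to 0, so they are eventually at most (1/2)^n,
  however large u is.\<close>

lemma summable_power_square:
  fixes u r :: real
  assumes "0 \<le> u" "0 \<le> r" "r < 1"
  shows "summable (\<lambda>n. u ^ n * r ^ n\<^sup>2)"
proof (rule summable_comparison_test_ev)
  have "(\<lambda>n. u * r ^ n) \<longlonglongrightarrow> u * 0"
    using assms by (intro tendsto_intros LIMSEQ_realpow_zero)
  then have "\<forall>\<^sub>F n in sequentially. u * r ^ n < 1 / 2"
    by (rule order_tendstoD) simp
  then show "\<forall>\<^sub>F n in sequentially. norm (u ^ n * r ^ n\<^sup>2) \<le> (1 / 2) ^ n"
  proof eventually_elim
    case (elim n)
    have "u ^ n * r ^ n\<^sup>2 = (u * r ^ n) ^ n"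
      by (simp add: power_mult_distrib power2_eq_square power_mult)
    also have "\<dots> \<le> (1 / 2) ^ n"
      using elim assms by (intro power_mono) auto
    finally show ?case using assms by simp
  qed
  show "summable (\<lambda>n. (1 / 2 :: real) ^ n)"
    by (rule summable_geometric) simp
qed

text \<open>Since (i + j)^2 \<ge> i^2 + j^2 and 0 \<le> r < 1, the terms are dominated by a product
  \<open>w i * w j\<close> of summable sequences.\<close>

lemma abs_summable_quadratic_exponent:
  fixes f :: "nat \<times> nat \<Rightarrow> 'a::real_normed_vector" and u r :: real
  assumes u: "0 \<le> u" and r: "0 \<le> r" "r < 1"
    and f: "\<And>i j. norm (f (i, j)) \<le> u ^ (i + j) * r ^ (i + j)\<^sup>2"
  shows "(\<lambda>p. norm (f p)) summable_on UNIV"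
proof -
  define w where "w n = u ^ n * r ^ n\<^sup>2" for n
  have w0: "0 \<le> w n" for n
    using u r by (simp add: w_def)
  have "w summable_on UNIV"
    using summable_power_square[OF u r] w0 unfolding w_def
    by (subst summable_on_UNIV_nonneg_real_iff) auto
  then have w: "(w has_sum infsum w UNIV) UNIV" by simp
  have "(\<lambda>(i, j). w i * w j) summable_on (UNIV \<times> UNIV)"
  proof (rule summable_on_SigmaI)
    show "((\<lambda>j. case (i, j) of (i, j) \<Rightarrow> w i * w j) has_sum w i * infsum w UNIV) UNIV" for i
      using has_sum_cmult_right[OF w] by simp
    show "(\<lambda>i. w i * infsum w UNIV) summable_on UNIV"
      using has_sum_cmult_left[OF w] by (auto simp: summable_on_def)
  qed (use w0 in auto)
  then show ?thesis
    unfolding UNIV_Times_UNIV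
  proof (rule Infinite_Sum.abs_summable_on_comparison_test')
    fix p :: "nat \<times> nat"
    obtain i j where p: "p = (i, j)" by fastforce
    have "r ^ (i + j)\<^sup>2 \<le> r ^ (i\<^sup>2 + j\<^sup>2)"
      using r by (intro power_decreasing) (auto simp: power2_sum)
    then have "u ^ (i + j) * r ^ (i + j)\<^sup>2 \<le> u ^ (i + j) * r ^ (i\<^sup>2 + j\<^sup>2)"
      using u by (intro mult_left_mono) auto
    also have "\<dots> = w i * w j"
      by (simp add: w_def power_add mult_ac)
    finally show "norm (f p) \<le> (case p of (i, j) \<Rightarrow> w i * w j)"
      using f[of i j] by (simp add: p)
  qed
qed

text \<open>Each factor has norm at least 1 - |Q|. A bound geometric in n suffices against the
  quadratic exponents.\<close>

lemma norm_qpoch_ge: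
  fixes Q :: "'a::{real_normed_field}"
  assumes "norm Q < 1"
  shows "(1 - norm Q) ^ n \<le> norm (qpoch Q Q n)"
proof (induction n)
  case (Suc n)
  have "norm (Q ^ Suc n) \<le> norm Q"
    using assms power_decreasing[of 1 "Suc n" "norm Q"] by (simp add: norm_power norm_mult)
  then have "1 - norm Q \<le> norm (1 - Q ^ Suc n)"
    using norm_triangle_ineq2[of 1 "Q ^ Suc n"] by simp
  then show ?case
    unfolding qpoch_Suc norm_mult power_Suc2 using Suc assms by (intro mult_mono) auto
qed (simp add: qpoch_def)

lemma qpoch_nonzero:
  fixes Q :: "'a::{real_normed_field}"
  assumes "norm Q < 1"
  shows "qpoch Q Q n \<noteq> 0"
proof -
  have "0 < (1 - norm Q) ^ n"
    using assms by simp
  then show ?thesis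
    using norm_qpoch_ge[OF assms, of n] by auto
qed

text \<open>With d = 1 - |q^k| the denominator has norm at least d^(i+j), which is absorbed by
  replacing |x| with |x|/d.\<close>

lemma abs_summable_div_qpoch:
  fixes x q :: "'a::{real_normed_field}" and c :: "nat \<times> nat \<Rightarrow> 'a"
  assumes q: "norm q < 1" and k: "0 < k"
    and c: "\<And>i j. norm (c (i, j)) \<le> norm x ^ (i + j) * norm q ^ (i + j)\<^sup>2"
  shows "(\<lambda>p. norm (case p of (i, j) \<Rightarrow> c (i, j) / (qpoch (q ^ k) (q ^ k) i * qpoch (q ^ k) (q ^ k) j)))
    summable_on UNIV"
proof (rule abs_summable_quadratic_exponent)
  define d where "d = 1 - norm (q ^ k)"
  have qk: "norm (q ^ k) < 1"
    using q k by (simp add: norm_power power_less_one_iff)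
  then have d: "0 < d" by (simp add: d_def)
  show "0 \<le> norm x / d" "0 \<le> norm q" "norm q < 1"
    using d q by auto
  fix i j
  have "d ^ (i + j) \<le> norm (qpoch (q ^ k) (q ^ k) i * qpoch (q ^ k) (q ^ k) j)"
    unfolding norm_mult power_add d_def
    using norm_qpoch_ge[OF qk] qk by (intro mult_mono) auto
  then have "norm (c (i, j)) / norm (qpoch (q ^ k) (q ^ k) i * qpoch (q ^ k) (q ^ k) j)
      \<le> norm x ^ (i + j) * norm q ^ (i + j)\<^sup>2 / d ^ (i + j)"
    using c d by (intro frac_le) auto
  then show "norm (case (i, j) of (i, j) \<Rightarrow> c (i, j) / (qpoch (q ^ k) (q ^ k) i * qpoch (q ^ k) (q ^ k) j))
      \<le> (norm x / d) ^ (i + j) * norm q ^ (i + j)\<^sup>2"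
    by (simp add: norm_divide power_divide)
qed

section \<open>Reciprocals and orders of formal power series\<close>

lemma fps_recip_unique:
  fixes f g :: "'a::comm_ring_1 fps"
  assumes "fps_nth f 0 = 1" "f * g = 1"
  shows "fps_recip f = g"
  using fps_recip[OF assms(1)] assms(2) by (metis mult.left_commute mult.right_neutral)

text \<open>Brings the reciprocal of two q-factorials into the form \<open>a i * a j\<close> of the
  diagonal sums.\<close>

lemma fps_recip_mult:
  fixes f g :: "'a::comm_ring_1 fps"
  assumes "fps_nth f 0 = 1" "fps_nth g 0 = 1"
  shows "fps_recip (f * g) = fps_recip f * fps_recip g"
proof (rule fps_recip_unique)
  have "f * g * (fps_recip f * fps_recip g) = (f * fps_recip f) * (g * fps_recip g)"
    by (simp only: mult_ac)
  then show "f * g * (fps_recip f * fps_recip g) = 1"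
    using assms by (simp add: fps_recip)
qed (use assms in simp)

lemma fps_nth_mult_X_power_mult_eq_0:
  fixes f g :: "'a::comm_ring_1 fps"
  assumes "n < k"
  shows "fps_nth (f * fps_X ^ k * g) n = 0"
proof -
  have "f * fps_X ^ k * g = fps_X ^ k * (f * g)"
    by (simp only: mult_ac)
  then show ?thesis using assms by (simp only: fps_X_power_mult_nth) simp
qed

text \<open>Both follow from n \<le> n^2 and give each formal summand order at least i + j in q, as
  the rearrangement by diagonals requires.\<close>

lemma le_quadratic_exponent: "i + j \<le> i\<^sup>2 + 2 * i * j + j\<^sup>2"
  "i + j \<le> 3 * i\<^sup>2 + 2 * i * j + 3 * j\<^sup>2" for i j :: nat
  using self_le_power[of i 2] self_le_power[of j 2] by (cases "i = 0"; cases "j = 0"; simp)+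

theorem theorem1p5:
  shows
    "(\<exists>S.
        ((\<lambda>(i, j). (-1) ^ j * formal_x ^ (i + j) * formal_q ^ (i^2 + 2 * i * j + j^2)
            * fps_recip (qpoch (formal_q ^ 8) (formal_q ^ 8) i * qpoch (formal_q ^ 8) (formal_q ^ 8) j))
          has_sum S) (UNIV :: (nat \<times> nat) set) \<and>
        ((\<lambda>n. formal_x ^ (2 * n) * formal_q ^ (4 * n^2)
            * fps_recip (qpoch (formal_q ^ 16) (formal_q ^ 16) n))
          has_sum S) (UNIV :: nat set)) \<and>
     (\<exists>S.
        ((\<lambda>(i, j). (-1) ^ nat (binom2 (int i - int j)) * formal_x ^ (i + j)
            * formal_q ^ (3 * i^2 + 2 * i * j + 3 * j^2)
            * fps_recip (qpoch (formal_q ^ 4) (formal_q ^ 4) i * qpoch (formal_q ^ 4) (formal_q ^ 4) j))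
          has_sum S) (UNIV :: (nat \<times> nat) set) \<and>
        ((\<lambda>n. formal_x ^ (2 * n) * formal_q ^ (8 * n^2)
            * fps_recip (qpoch (formal_q ^ 8) (formal_q ^ 8) n))
          has_sum S) (UNIV :: nat set)) \<and>
     (\<forall>x q :: complex. norm q < 1 \<longrightarrow>
       (\<exists>S.
          ((\<lambda>(i, j). (-1) ^ j * x ^ (i + j) * q ^ (i^2 + 2 * i * j + j^2)
              / (qpoch (q ^ 8) (q ^ 8) i * qpoch (q ^ 8) (q ^ 8) j))
            has_sum S) (UNIV :: (nat \<times> nat) set) \<and>
          ((\<lambda>n. x ^ (2 * n) * q ^ (4 * n^2) / qpoch (q ^ 16) (q ^ 16) n)
            has_sum S) (UNIV :: nat set)) \<and>
       (\<exists>S.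
          ((\<lambda>(i, j). (-1) ^ nat (binom2 (int i - int j)) * x ^ (i + j)
              * q ^ (3 * i^2 + 2 * i * j + 3 * j^2)
              / (qpoch (q ^ 4) (q ^ 4) i * qpoch (q ^ 4) (q ^ 4) j))
            has_sum S) (UNIV :: (nat \<times> nat) set) \<and>
          ((\<lambda>n. x ^ (2 * n) * q ^ (8 * n^2) / qpoch (q ^ 8) (q ^ 8) n)
            has_sum S) (UNIV :: nat set)))"
proof (intro conjI allI impI)
  let ?p = "\<lambda>k n. qpoch (formal_q ^ k) (formal_q ^ k) n"
  have recip: "fps_recip (?p k n) * ?p k n = 1" if "0 < k" for k n
    using fps_recip[OF fps_nth_0_qpoch_fps_X[OF that]] by (simp add: mult.commute)
  have recip_mult: "fps_recip (?p k i * ?p k j) = fps_recip (?p k i) * fps_recip (?p k j)"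
    if "0 < k" for k i j
    using that by (intro fps_recip_mult fps_nth_0_qpoch_fps_X)
  show "\<exists>S. ((\<lambda>(i, j). (-1) ^ j * formal_x ^ (i + j) * formal_q ^ (i^2 + 2 * i * j + j^2)
        * fps_recip (?p 8 i * ?p 8 j)) has_sum S) (UNIV :: (nat \<times> nat) set) \<and>
      ((\<lambda>n. formal_x ^ (2 * n) * formal_q ^ (4 * n^2) * fps_recip (?p 16 n)) has_sum S) UNIV"
    (is "\<exists>S. (?f has_sum S) UNIV \<and> _")
  proof -
    obtain S where S: "(?f has_sum S) UNIV" "((\<lambda>N. \<Sum>i\<le>N. ?f (i, N - i)) has_sum S) UNIV"
    proof (rule fps_has_sum_diagonals[of ?f])
      show "fps_nth (?f (i, j)) n = 0" if "n < i + j" for i j n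
        unfolding prod.case
        by (intro fps_nth_mult_X_power_mult_eq_0 less_le_trans[OF that] le_quadratic_exponent)
    qed
    have "(\<Sum>i\<le>N. ?f (i, N - i)) = (if even N then formal_x ^ (2 * (N div 2)) * formal_q ^ (4 * (N div 2)\<^sup>2)
        * fps_recip (?p 16 (N div 2)) else 0)" for N
      by (rule diagonal_sum1[where a = "\<lambda>n. fps_recip (?p 8 n)" and
            e = "\<lambda>n. fps_recip (?p 16 n)"]) (simp_all only: recip recip_mult prod.case zero_less_numeral)
    then have "((\<lambda>n. formal_x ^ (2 * n) * formal_q ^ (4 * n\<^sup>2) * fps_recip (?p 16 n)) has_sum S) UNIV"
      by (rule has_sum_even_supported[OF S(2)])
    then show ?thesis using S(1) by blast
  qed
  show "\<exists>S. ((\<lambda>(i, j). (-1) ^ nat (binom2 (int i - int j)) * formal_x ^ (i + j)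
        * formal_q ^ (3 * i^2 + 2 * i * j + 3 * j^2)
        * fps_recip (?p 4 i * ?p 4 j)) has_sum S) (UNIV :: (nat \<times> nat) set) \<and>
      ((\<lambda>n. formal_x ^ (2 * n) * formal_q ^ (8 * n^2) * fps_recip (?p 8 n)) has_sum S) UNIV"
    (is "\<exists>S. (?f has_sum S) UNIV \<and> _")
  proof -
    obtain S where S: "(?f has_sum S) UNIV" "((\<lambda>N. \<Sum>i\<le>N. ?f (i, N - i)) has_sum S) UNIV"
    proof (rule fps_has_sum_diagonals[of ?f])
      show "fps_nth (?f (i, j)) n = 0" if "n < i + j" for i j n
        unfolding prod.case
        by (intro fps_nth_mult_X_power_mult_eq_0 less_le_trans[OF that] le_quadratic_exponent)
    qed
    have "(\<Sum>i\<le>N. ?f (i, N - i)) = (if even N then formal_x ^ (2 * (N div 2)) * formal_q ^ (8 * (N div 2)\<^sup>2)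
        * fps_recip (?p 8 (N div 2)) else 0)" for N
      by (rule diagonal_sum2[where a = "\<lambda>n. fps_recip (?p 4 n)" and
            e = "\<lambda>n. fps_recip (?p 8 n)"]) (simp_all only: recip recip_mult prod.case zero_less_numeral)
    then have "((\<lambda>n. formal_x ^ (2 * n) * formal_q ^ (8 * n\<^sup>2) * fps_recip (?p 8 n)) has_sum S) UNIV"
      by (rule has_sum_even_supported[OF S(2)])
    then show ?thesis using S(1) by blast
  qed
next
  fix x q :: complex
  assume q: "norm q < 1"
  let ?p = "\<lambda>k n. qpoch (q ^ k) (q ^ k) n"
  \<comment> \<open>For |q| < 1 no q-factorial vanishes, so no quotient takes the default value of
    division by 0.\<close>
  have recip: "1 / ?p k n * ?p k n = 1" if "0 < k" for k n
    using q that qpoch_nonzero[of "q ^ k" n] by (simp add: norm_power power_less_one_iff)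
  show "\<exists>S. ((\<lambda>(i, j). (-1) ^ j * x ^ (i + j) * q ^ (i^2 + 2 * i * j + j^2)
        / (?p 8 i * ?p 8 j)) has_sum S) (UNIV :: (nat \<times> nat) set) \<and>
      ((\<lambda>n. x ^ (2 * n) * q ^ (4 * n^2) / ?p 16 n) has_sum S) UNIV"
    (is "\<exists>S. (?f has_sum S) UNIV \<and> _")
  proof -
    have "norm ((-1) ^ j * x ^ (i + j) * q ^ (i\<^sup>2 + 2 * i * j + j\<^sup>2))
        \<le> norm x ^ (i + j) * norm q ^ (i + j)\<^sup>2" for i j
      by (simp add: norm_mult norm_power power2_sum add_ac)
    then have "(\<lambda>p. norm (?f p)) summable_on UNIV"
      using abs_summable_div_qpoch[OF q, of 8
          "\<lambda>(i, j). (-1) ^ j * x ^ (i + j) * q ^ (i\<^sup>2 + 2 * i * j + j\<^sup>2)" x] by simp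
    then obtain S where S: "(?f has_sum S) UNIV" "((\<lambda>N. \<Sum>i\<le>N. ?f (i, N - i)) has_sum S) UNIV"
      by (rule has_sum_diagonals)
    have "(\<Sum>i\<le>N. ?f (i, N - i)) = (if even N then x ^ (2 * (N div 2)) * q ^ (4 * (N div 2)\<^sup>2)
        * (1 / ?p 16 (N div 2)) else 0)" for N
      by (rule diagonal_sum1[where a = "\<lambda>n. 1 / ?p 8 n"]) (simp_all only: recip zero_less_numeral, simp)
    then have "((\<lambda>n. x ^ (2 * n) * q ^ (4 * n\<^sup>2) * (1 / ?p 16 n)) has_sum S) UNIV"
      by (rule has_sum_even_supported[OF S(2)])
    then show ?thesis using S(1) by auto
  qed
  show "\<exists>S. ((\<lambda>(i, j). (-1) ^ nat (binom2 (int i - int j)) * x ^ (i + j)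
        * q ^ (3 * i^2 + 2 * i * j + 3 * j^2)
        / (?p 4 i * ?p 4 j)) has_sum S) (UNIV :: (nat \<times> nat) set) \<and>
      ((\<lambda>n. x ^ (2 * n) * q ^ (8 * n^2) / ?p 8 n) has_sum S) UNIV"
    (is "\<exists>S. (?f has_sum S) UNIV \<and> _")
  proof -
    \<comment> \<open>The exponent exceeds (i + j)^2 by 2i^2 + 2j^2, which cannot enlarge the power
      as |q| < 1.\<close>
    have "norm ((-1) ^ nat (binom2 (int i - int j)) * x ^ (i + j)
          * q ^ (3 * i\<^sup>2 + 2 * i * j + 3 * j\<^sup>2))
        \<le> norm x ^ (i + j) * norm q ^ (i + j)\<^sup>2" for i j
      unfolding norm_mult norm_power using q
      by (auto intro!: mult_left_mono power_decreasing simp: power2_sum)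
    then have "(\<lambda>p. norm (?f p)) summable_on UNIV"
      using abs_summable_div_qpoch[OF q, of 4 "\<lambda>(i, j). (-1) ^ nat (binom2 (int i - int j))
          * x ^ (i + j) * q ^ (3 * i\<^sup>2 + 2 * i * j + 3 * j\<^sup>2)" x] by simp
    then obtain S where S: "(?f has_sum S) UNIV" "((\<lambda>N. \<Sum>i\<le>N. ?f (i, N - i)) has_sum S) UNIV"
      by (rule has_sum_diagonals)
    have "(\<Sum>i\<le>N. ?f (i, N - i)) = (if even N then x ^ (2 * (N div 2)) * q ^ (8 * (N div 2)\<^sup>2)
        * (1 / ?p 8 (N div 2)) else 0)" for N
      by (rule diagonal_sum2[where a = "\<lambda>n. 1 / ?p 4 n"]) (simp_all only: recip zero_less_numeral, simp)
    then have "((\<lambda>n. x ^ (2 * n) * q ^ (8 * n\<^sup>2) * (1 / ?p 8 n)) has_sum S) UNIV"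
      by (rule has_sum_even_supported[OF S(2)])
    then show ?thesis using S(1) by auto
  qed
qed

end
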